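(* Let $\eta>0$ and $0<r_{\min}<r_{\max}$, and set $\ell_{\max}=2r_{\max}\max(\eta,1)$. Let $k$ be the spheroid kernel with shape parameter $\eta$ (defined in the context). Then the linear operator $$\mathcal K: L^2((r_{\min},r_{\max});\mathbb R)\to L^2((0,\ell_{\max});\mathbb R),\qquad (\mathcal K\psi)(\ell)=\int_{r_{\min}}^{r_{\max}}k(\ell,r)\,\psi(r)\,dr$$ is injective.
   Context: For $\eta>0$, $\phi\in[0,2\pi]$, $\theta\in[0,\pi]$ let $$\alpha_\eta(\phi,\theta)=\frac{\cos^2\phi}{\cos^2\theta+\eta^2\sin^2\theta}+\sin^2\phi .$$ For $\ell\ge 0$ and $r>0$ the spheroid kernel with shape parameter $\eta$ is $$k(\ell,r)=1-\int_0^{2\pi}\int_0^{\pi}\sqrt{1-\left(\frac{\ell}{2r}\right)^2\alpha_\eta(\phi,\theta)}\;\frac{\sin\theta}{4\pi}\,d\theta\,d\phi ,$$ where the square root is taken to be $0$ whenever $1-\left(\frac{\ell}{2r}\right)^2\alpha_\eta(\phi,\theta)<0$. *)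

theory Defs
  imports "HOL-Analysis.Analysis"
begin

definition spheroid_alpha :: "real \<Rightarrow> real \<Rightarrow> real \<Rightarrow> real" where
  "spheroid_alpha \<eta> \<phi> \<theta> =
     (cos \<phi>)\<^sup>2 / ((cos \<theta>)\<^sup>2 + \<eta>\<^sup>2 * (sin \<theta>)\<^sup>2) + (sin \<phi>)\<^sup>2"

text \<open>The library's \<open>sqrt\<close> is odd, hence negative on negative arguments; the kernel needs
  the root that vanishes there.\<close>

definition sqrt0 :: "real \<Rightarrow> real" where
  "sqrt0 x = (if x < 0 then 0 else sqrt x)"

definition spheroid_kernel :: "real \<Rightarrow> real \<Rightarrow> real \<Rightarrow> real" where
  "spheroid_kernel \<eta> l r =
     1 - (LBINT \<phi>:{0..2*pi}. (LBINT \<theta>:{0..pi}.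
            sqrt0 (1 - (l / (2*r))\<^sup>2 * spheroid_alpha \<eta> \<phi> \<theta>) * (sin \<theta> / (4*pi))))"

text \<open>The space \<open>L\<^sup>2((a,b))\<close> consists of the classes, modulo equality almost everywhere on
  \<open>(a,b)\<close>, of Lebesgue measurable, square-integrable functions. Representatives are total
  functions on the reals whose values outside \<open>(a,b)\<close> play no role.\<close>

definition square_integrable :: "real \<Rightarrow> real \<Rightarrow> (real \<Rightarrow> real) set" where
  "square_integrable a b =
     {f \<in> borel_measurable (lebesgue_on {a<..<b}).
        integrable (lebesgue_on {a<..<b}) (\<lambda>x. (f x)\<^sup>2)}"

definition ae_rel :: "real \<Rightarrow> real \<Rightarrow> ((real \<Rightarrow> real) \<times> (real \<Rightarrow> real)) set" where
  "ae_rel a b =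
     {(f, g). f \<in> square_integrable a b \<and> g \<in> square_integrable a b \<and>
        (AE x in lebesgue_on {a<..<b}. f x = g x)}"

definition L2 :: "real \<Rightarrow> real \<Rightarrow> (real \<Rightarrow> real) set set" where
  "L2 a b = square_integrable a b // ae_rel a b"

text \<open>This is a member of \<open>L2 a b\<close> exactly when \<open>f\<close> is square-integrable on \<open>(a,b)\<close>;
  otherwise it is empty.\<close>

definition L2_class :: "real \<Rightarrow> real \<Rightarrow> (real \<Rightarrow> real) \<Rightarrow> (real \<Rightarrow> real) set" where
  "L2_class a b f = ae_rel a b `` {f}"

definition L2_add ::
  "real \<Rightarrow> real \<Rightarrow> (real \<Rightarrow> real) set \<Rightarrow> (real \<Rightarrow> real) set \<Rightarrow> (real \<Rightarrow> real) set" where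
  "L2_add a b F G = (\<Union>f\<in>F. \<Union>g\<in>G. L2_class a b (\<lambda>x. f x + g x))"

definition L2_scale ::
  "real \<Rightarrow> real \<Rightarrow> real \<Rightarrow> (real \<Rightarrow> real) set \<Rightarrow> (real \<Rightarrow> real) set" where
  "L2_scale a b t F = (\<Union>f\<in>F. L2_class a b (\<lambda>x. t * f x))"

definition L2_linear_operator ::
  "real \<Rightarrow> real \<Rightarrow> real \<Rightarrow> real \<Rightarrow> ((real \<Rightarrow> real) set \<Rightarrow> (real \<Rightarrow> real) set) \<Rightarrow> bool" where
  "L2_linear_operator a b c d T \<longleftrightarrow>
     T \<in> L2 a b \<rightarrow> L2 c d \<and>
     (\<forall>F\<in>L2 a b. \<forall>G\<in>L2 a b. T (L2_add a b F G) = L2_add c d (T F) (T G)) \<and>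
     (\<forall>t. \<forall>F\<in>L2 a b. T (L2_scale a b t F) = L2_scale c d t (T F))"

definition spheroid_transform ::
  "real \<Rightarrow> real \<Rightarrow> real \<Rightarrow> (real \<Rightarrow> real) \<Rightarrow> real \<Rightarrow> real" where
  "spheroid_transform \<eta> r_min r_max \<psi> l =
     (\<integral>r. spheroid_kernel \<eta> l r * \<psi> r \<partial>lebesgue_on {r_min<..<r_max})"

text \<open>The operator induced on classes. The union is a single class precisely because the
  transform does not depend on the representative.\<close>

definition spheroid_operator ::
  "real \<Rightarrow> real \<Rightarrow> real \<Rightarrow> real \<Rightarrow> (real \<Rightarrow> real) set \<Rightarrow> (real \<Rightarrow> real) set" where
  "spheroid_operator \<eta> r_min r_max l_max F =
     (\<Union>\<psi>\<in>F. L2_class 0 l_max (spheroid_transform \<eta> r_min r_max \<psi>))"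

end

theory Submission
  imports Defs "HOL-Complex_Analysis.Cauchy_Integral_Formula"
begin

text \<open>Only lengths \<open>l\<close> near \<open>0\<close> are needed. There the binomial series of the square root turns
  the transform of \<open>\<psi>\<close> into a power series in \<open>l\<^sup>2\<close>, whose \<open>n\<close>-th coefficient for \<open>n > 0\<close> is a
  nonzero multiple of \<open>\<integral> (2r)\<^bsup>-2n\<^esup> \<psi>(r) dr\<close>: the factor is a binomial coefficient times the
  \<open>n\<close>-th moment of the positive function \<open>\<alpha>\<close>. If the transform vanishes, so do all these integrals,
  and the Weierstrass theorem in the variable \<open>(2r)\<^bsup>-2\<^esup>\<close> gives \<open>\<psi> = 0\<close> almost everywhere.\<close>

subsection \<open>Functions with vanishing moments\<close>

text \<open>The expansion has no constant term: the angular weight has total mass one, so the kernel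
  vanishes at \<open>l = 0\<close>, and the integral of \<open>\<psi>\<close> itself stays out of
  reach. Weierstrass approximation uses all powers, including the zeroth, so it is applied to
  \<open>\<psi> r / (2*r)\<^sup>2\<close>, whose moment of order \<open>n\<close> is that of
  \<open>\<psi>\<close> of order \<open>n + 1\<close>; the extra factor has no zeros on the
  interval. The truncation of the root does not disturb the series: \<open>\<alpha>\<close> is
  bounded and \<open>r\<close> stays above \<open>r_min > 0\<close>, so for small \<open>l\<close>
  the radicand is positive for all angles and radii at once, and one radius of convergence serves
  the whole integral. The transform is known to vanish only almost everywhere. This is enough, since
  a power series that vanishes at 0 and has a nonzero coefficient has no other zeros near 0, whereas
  a set of full measure contains points arbitrarily close to 0.\<close>

lemma borel_measurable_indicator_times_lebesgue_on:
  fixes f :: "'a::euclidean_space \<Rightarrow> real"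
  assumes "integrable (lebesgue_on S) f" "A \<in> sets lebesgue"
  shows "(\<lambda>x. indicator A x * f x) \<in> borel_measurable (lebesgue_on S)"
proof (rule borel_measurable_times)
  show "indicator A \<in> borel_measurable (lebesgue_on S)"
    using assms(2) by (intro measurable_restrict_space1 borel_measurable_indicator)
qed (use assms(1) in auto)

text \<open>The indicator of a closed set is the pointwise limit of continuous functions with values
  between 0 and 1, so dominated convergence with majorant \<open>\<bar>f x\<bar>\<close> carries
  orthogonality over.\<close>

lemma integral_indicator_closed_eq_0:
  fixes f :: "'a::euclidean_space \<Rightarrow> real"
  assumes f: "integrable (lebesgue_on S) f"
    and orth: "\<And>g. continuous_on UNIV g \<Longrightarrow> bounded (range g) \<Longrightarrow>
      (\<integral>x. g x * f x \<partial>lebesgue_on S) = 0"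
    and A: "closed A"
  shows "(\<integral>x. indicator A x * f x \<partial>lebesgue_on S) = 0"
\<comment> \<open>\<open>infdist x {}\<close> is 0 by convention, so for empty \<open>A\<close> the
  functions \<open>g n\<close> below would be constantly 1 and miss the indicator.\<close>
proof (cases "A = {}")
  case False
  define g where "g n x = max 0 (1 - real n * infdist x A)" for n x
  have cont: "continuous_on UNIV (g n)" for n
    unfolding g_def by (intro continuous_intros)
  have bnd: "\<bar>g n x\<bar> \<le> 1" for n x
    unfolding g_def by (auto simp: infdist_nonneg)
  have meas: "g n \<in> borel_measurable (lebesgue_on S)" for n
    by (intro measurable_restrict_space1 measurable_completion)
       (simp add: borel_measurable_continuous_onI cont)
  have Am: "A \<in> sets lebesgue"
    using A by simp
  have "(\<lambda>n. \<integral>x. g n x * f x \<partial>lebesgue_on S)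
      \<longlonglongrightarrow> (\<integral>x. indicator A x * f x \<partial>lebesgue_on S)"
  proof (rule integral_dominated_convergence[where w = "\<lambda>x. \<bar>f x\<bar>"])
    show "(\<lambda>x. indicator A x * f x) \<in> borel_measurable (lebesgue_on S)"
      by (rule borel_measurable_indicator_times_lebesgue_on[OF f Am])
    show "(\<lambda>x. g n x * f x) \<in> borel_measurable (lebesgue_on S)" for n
      using f meas by auto
    show "integrable (lebesgue_on S) (\<lambda>x. \<bar>f x\<bar>)"
      using f by auto
    show "AE x in lebesgue_on S. norm (g n x * f x) \<le> \<bar>f x\<bar>" for n
      using bnd by (auto simp: abs_mult intro!: mult_left_le_one_le)
    have "(\<lambda>n. g n x) \<longlonglongrightarrow> indicator A x" for x
    proof (cases "x \<in> A")
      case True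
      then show ?thesis by (simp add: g_def)
    next
      case nA: False
      then have pos: "infdist x A > 0"
        using A False by (simp add: infdist_pos_not_in_closed)
      obtain N where N: "1 / infdist x A < real N"
        using reals_Archimedean2 by blast
      have "\<forall>n\<ge>N. g n x = 0"
      proof (intro allI impI)
        fix n assume "n \<ge> N"
        then have "1 / infdist x A < real n" using N by linarith
        then have "1 < real n * infdist x A" using pos by (simp add: field_simps)
        then show "g n x = 0" by (simp add: g_def)
      qed
      then have "\<forall>\<^sub>F n in sequentially. g n x = 0"
        by (auto simp: eventually_sequentially)
      then show ?thesis
        using nA by (simp add: tendsto_eventually)
    qed
    then show "AE x in lebesgue_on S. (\<lambda>n. g n x * f x) \<longlonglongrightarrow> indicator A x * f x"
      by (intro AE_I2 tendsto_intros)
  qed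
  moreover have "(\<integral>x. g n x * f x \<partial>lebesgue_on S) = 0" for n
    using bnd by (intro orth cont) (auto simp: bounded_iff)
  ultimately show ?thesis
    by (simp add: LIMSEQ_const_iff)
qed simp

text \<open>Vanishing integrals over all measurable sets force \<open>f\<close> to vanish almost
  everywhere. Closed sets are settled by the preceding lemma; a Lebesgue measurable set is a
  countable union of closed sets up to a null set.\<close>

lemma AE_eq_0_if_orthogonal_to_continuous:
  fixes f :: "'a::euclidean_space \<Rightarrow> real"
  assumes f: "integrable (lebesgue_on S) f" and lmS: "S \<in> lmeasurable"
    and orth: "\<And>g. continuous_on UNIV g \<Longrightarrow> bounded (range g) \<Longrightarrow>
      (\<integral>x. g x * f x \<partial>lebesgue_on S) = 0"
  shows "AE x in lebesgue_on S. f x = 0"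
proof -
  have S: "S \<in> sets lebesgue"
    using lmS by blast
  interpret finite_measure "lebesgue_on S"
    by (rule finite_measure_lebesgue_on[OF lmS])
  show ?thesis
  proof (rule density_zero[OF f])
    fix A assume "A \<in> sets (lebesgue_on S)"
    then have "A \<in> sets lebesgue"
      using S by (simp add: sets_restrict_space_iff)
    then obtain C T where C: "fsigma C" and T: "T \<in> null_sets lebesgue" and CT: "C \<union> T = A"
      by (rule lebesgue_set_almost_fsigma)
    obtain F :: "nat \<Rightarrow> 'a set" where F: "\<And>n. closed (F n)" "C = (\<Union>n. F n)"
      using C unfolding fsigma.simps by blast
    \<comment> \<open>Finite unions stay closed and increase to \<open>C\<close>, so their
      indicators converge pointwise to that of \<open>C\<close>.\<close>
    define G where "G n = (\<Union>i\<le>n. F i)" for n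
    have G: "closed (G n)" for n
      unfolding G_def using F by auto
    have Cm: "C \<in> sets lebesgue"
      unfolding F(2) using F(1) by (intro sets.countable_UN) auto
    have lim: "(\<lambda>n. \<integral>x. indicator (G n) x * f x \<partial>lebesgue_on S)
        \<longlonglongrightarrow> (\<integral>x. indicator C x * f x \<partial>lebesgue_on S)"
    proof (rule integral_dominated_convergence[where w = "\<lambda>x. \<bar>f x\<bar>"])
      show "(\<lambda>x. indicator C x * f x) \<in> borel_measurable (lebesgue_on S)"
        by (rule borel_measurable_indicator_times_lebesgue_on[OF f Cm])
      show "(\<lambda>x. indicator (G n) x * f x) \<in> borel_measurable (lebesgue_on S)" for n
        using G[of n] by (intro borel_measurable_indicator_times_lebesgue_on[OF f]) auto
      show "integrable (lebesgue_on S) (\<lambda>x. \<bar>f x\<bar>)"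
        using f by auto
      show "AE x in lebesgue_on S. norm (indicator (G n) x * f x) \<le> \<bar>f x\<bar>" for n
        by (auto simp: indicator_def)
      have "incseq G"
        unfolding G_def by (intro monoI UN_mono) auto
      moreover have "(\<Union>n. G n) = C"
        unfolding G_def F(2) by auto
      ultimately have "(\<lambda>n. indicator (G n) x :: real) \<longlonglongrightarrow> indicator C x" for x
        using LIMSEQ_indicator_incseq[of G x] by simp
      then show "AE x in lebesgue_on S. (\<lambda>n. indicator (G n) x * f x) \<longlonglongrightarrow> indicator C x * f x"
        by (intro AE_I2 tendsto_intros)
    qed
    have "(\<integral>x. indicator (G n) x * f x \<partial>lebesgue_on S) = 0" for n
      using integral_indicator_closed_eq_0[OF f orth G] .
    with lim have C0: "(\<integral>x. indicator C x * f x \<partial>lebesgue_on S) = 0"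
      by (simp add: LIMSEQ_const_iff)
    have "AE x in lebesgue. x \<notin> T"
      using T by (rule AE_not_in)
    then have "AE x in lebesgue_on S. indicator A x = (indicator C x :: real)"
      using S by (subst AE_restrict_space_iff) (auto simp: CT[symmetric] indicator_def)
    then have "(\<integral>x. indicator A x * f x \<partial>lebesgue_on S) = (\<integral>x. indicator C x * f x \<partial>lebesgue_on S)"
      using Cm \<open>A \<in> sets lebesgue\<close>
      by (intro integral_cong_AE borel_measurable_indicator_times_lebesgue_on[OF f]) auto
    with C0 show "set_lebesgue_integral (lebesgue_on S) A f = 0"
      by (simp add: set_lebesgue_integral_def)
  qed
qed

text \<open>A continuous injection on a compact interval is a homeomorphism onto its image. Hence
  every continuous \<open>g\<close> is on \<open>{a..b}\<close> a continuous function of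
  \<open>q x\<close>, and is uniformly approximated there by polynomials in \<open>q x\<close>, all
  of which are orthogonal to \<open>f\<close>.\<close>

lemma AE_eq_0_if_moments_eq_0:
  fixes f q :: "real \<Rightarrow> real"
  assumes f: "integrable (lebesgue_on {a<..<b}) f"
    and q: "continuous_on {a..b} q" "inj_on q {a..b}"
    and mom: "\<And>n. (\<integral>x. q x ^ n * f x \<partial>lebesgue_on {a<..<b}) = 0"
  shows "AE x in lebesgue_on {a<..<b}. f x = 0"
proof (rule AE_eq_0_if_orthogonal_to_continuous[OF f])
  let ?N = "lebesgue_on {a<..<b}"
  fix g :: "real \<Rightarrow> real" assume g: "continuous_on UNIV g" "bounded (range g)"
  define K where "K = q ` {a..b}"
  have K: "compact K"
    unfolding K_def using q(1) by (simp add: compact_continuous_image)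
  define h where "h = g \<circ> the_inv_into {a..b} q"
  have h: "continuous_on K h"
    unfolding h_def K_def
    by (intro continuous_on_compose continuous_on_inv_into q compact_Icc continuous_on_subset[OF g(1)]) auto
  have hq: "h (q x) = g x" if "x \<in> {a<..<b}" for x
    using that q(2) by (simp add: h_def the_inv_into_f_f)
  have qm: "q \<in> borel_measurable ?N"
    by (intro continuous_imp_measurable_on_sets_lebesgue continuous_on_subset[OF q(1)]) auto
  have gm: "g \<in> borel_measurable ?N"
    by (intro continuous_imp_measurable_on_sets_lebesgue continuous_on_subset[OF g(1)]) auto
  obtain B where B: "\<And>x. x \<in> K \<Longrightarrow> \<bar>x\<bar> \<le> B"
    using compact_imp_bounded[OF K] by (auto simp: bounded_iff)
  have qn: "integrable ?N (\<lambda>x. q x ^ n * f x)" for n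
  proof (rule Bochner_Integration.integrable_bound)
    show "integrable ?N (\<lambda>x. B ^ n * f x)" using f by simp
    show "(\<lambda>x. q x ^ n * f x) \<in> borel_measurable ?N" using qm f by auto
    have "\<bar>q x\<bar> ^ n \<le> \<bar>B\<bar> ^ n" if "x \<in> {a<..<b}" for x
      using B[of "q x"] that by (intro power_mono) (auto simp: K_def)
    then show "AE x in ?N. norm (q x ^ n * f x) \<le> norm (B ^ n * f x)"
      by (intro AE_I2) (auto simp: abs_mult power_abs intro!: mult_right_mono)
  qed
  obtain B' where B': "\<And>x. \<bar>g x\<bar> \<le> B'"
    using g(2) by (auto simp: bounded_iff)
  have gf: "integrable ?N (\<lambda>x. g x * f x)"
  proof (rule Bochner_Integration.integrable_bound)
    show "integrable ?N (\<lambda>x. B' * f x)" using f by simp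
    show "(\<lambda>x. g x * f x) \<in> borel_measurable ?N" using gm f by auto
    show "AE x in ?N. norm (g x * f x) \<le> norm (B' * f x)"
      using B' by (intro AE_I2) (auto simp: abs_mult intro!: mult_right_mono intro: order_trans[OF _ abs_ge_self])
  qed
  have "\<bar>\<integral>x. g x * f x \<partial>?N\<bar> \<le> e * (\<integral>x. \<bar>f x\<bar> \<partial>?N)" if e: "e > 0" for e
  proof -
    obtain p where p: "real_polynomial_function p" "\<And>x. x \<in> K \<Longrightarrow> \<bar>h x - p x\<bar> < e"
      using Stone_Weierstrass_real_polynomial_function[OF K h e] by blast
    obtain c n where pc: "p = (\<lambda>x. \<Sum>i\<le>n. c i * x ^ i)"
      using p(1) unfolding real_polynomial_function_iff_sum by blast
    have pf: "(\<lambda>x. p (q x) * f x) = (\<lambda>x. \<Sum>i\<le>n. c i * (q x ^ i * f x))"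
      by (simp add: pc sum_distrib_right mult.assoc)
    have pfi: "integrable ?N (\<lambda>x. p (q x) * f x)"
      unfolding pf using qn by (intro Bochner_Integration.integrable_sum integrable_mult_right) auto
    have "(\<integral>x. p (q x) * f x \<partial>?N) = 0"
      unfolding pf by (subst Bochner_Integration.integral_sum) (auto simp: mom intro!: integrable_mult_right qn)
    then have "(\<integral>x. g x * f x \<partial>?N) = (\<integral>x. g x * f x - p (q x) * f x \<partial>?N)"
      using gf pfi by simp
    also have "\<bar>\<dots>\<bar> \<le> (\<integral>x. \<bar>g x * f x - p (q x) * f x\<bar> \<partial>?N)"
      by (rule integral_abs_bound)
    also have "\<dots> \<le> (\<integral>x. e * \<bar>f x\<bar> \<partial>?N)"
    proof (rule integral_mono)
      show "integrable ?N (\<lambda>x. \<bar>g x * f x - p (q x) * f x\<bar>)" using gf pfi by auto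
      show "integrable ?N (\<lambda>x. e * \<bar>f x\<bar>)" using f by auto
      fix x assume "x \<in> space ?N"
      then have x: "x \<in> {a<..<b}" by simp
      then have "\<bar>g x - p (q x)\<bar> \<le> e"
        using p(2)[of "q x"] hq[of x] by (force simp: K_def)
      then show "\<bar>g x * f x - p (q x) * f x\<bar> \<le> e * \<bar>f x\<bar>"
        by (simp add: left_diff_distrib[symmetric] abs_mult mult_right_mono)
    qed
    finally show ?thesis by simp
  qed
  \<comment> \<open>The previous bound is used at \<open>e\<close> divided by one plus the integral
    of \<open>\<bar>f x\<bar>\<close>; adding one avoids a division by zero.\<close>
  then have "\<bar>\<integral>x. g x * f x \<partial>?N\<bar> \<le> 0 + e" if "e > 0" for e
  proof -
    have "(\<integral>x. \<bar>f x\<bar> \<partial>?N) \<ge> 0" by simp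
    then have "e / (1 + (\<integral>x. \<bar>f x\<bar> \<partial>?N)) * (\<integral>x. \<bar>f x\<bar> \<partial>?N) \<le> e"
      using that by (simp add: field_simps add_pos_nonneg)
    moreover have "e / (1 + (\<integral>x. \<bar>f x\<bar> \<partial>?N)) > 0"
      using that by (intro divide_pos_pos add_pos_nonneg) auto
    ultimately show ?thesis
      using \<open>\<And>e. e > 0 \<Longrightarrow> \<bar>\<integral>x. g x * f x \<partial>?N\<bar> \<le> e * (\<integral>x. \<bar>f x\<bar> \<partial>?N)\<close> by force
  qed
  then show "(\<integral>x. g x * f x \<partial>?N) = 0"
    using field_le_epsilon[of "\<bar>\<integral>x. g x * f x \<partial>?N\<bar>" 0] by simp
qed simp

subsection \<open>Power series of integrals\<close>

text \<open>Consecutive coefficients have the ratio \<open>(1/2 - n) / (n + 1)\<close>, of modulus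
  at most 1. The bound lets a geometric series dominate the binomial series.\<close>

lemma abs_gbinomial_half_le_1: "\<bar>(1/2 :: real) gchoose n\<bar> \<le> 1"
proof (induction n)
  case (Suc n)
  have "real (Suc n) * ((1/2) gchoose Suc n) = (1/2 - real n) * ((1/2) gchoose n)"
    using gbinomial_absorb_comp[of "1/2::real" n] gbinomial_absorption[of n "1/2::real"] by simp
  then have "\<bar>real (Suc n)\<bar> * \<bar>(1/2 :: real) gchoose Suc n\<bar> = \<bar>1/2 - real n\<bar> * \<bar>(1/2) gchoose n\<bar>"
    by (metis abs_mult)
  also have "\<dots> \<le> real (Suc n) * 1"
    using Suc by (intro mult_mono) auto
  finally show ?case by simp
qed simp

text \<open>The numerator is a product of factors \<open>1/2 - i\<close>, none of which is zero
  because 1/2 is not an integer. For a natural exponent the series would break off and lose the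
  higher moments.\<close>

lemma gbinomial_half_neq_0: "((1/2 :: real) gchoose n) \<noteq> 0"
proof -
  have "2 * real i \<noteq> 1" for i
    by (metis even_numeral dvd_triv_left even_mult_iff odd_one of_nat_1 of_nat_eq_iff of_nat_mult of_nat_numeral)
  then have "1/2 - real i \<noteq> 0" for i
    by (metis eq_iff_diff_eq_0 nonzero_mult_div_cancel_left times_divide_eq_right mult.commute mult_cancel_right1 zero_neq_numeral)
  then show ?thesis
    by (simp add: gbinomial_prod_rev)
qed

text \<open>Sum and integral are exchanged because \<open>\<bar>q x\<bar> \<le> Q\<close> makes the
  numerical series at \<open>\<bar>v\<bar> * Q\<close> a majorant. It serves twice: over the angles,
  with \<open>q\<close> being \<open>\<alpha>\<close> and \<open>\<psi>\<close> being 1, and over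
  the radii, with \<open>q r = 1 / (2*r)\<^sup>2\<close> and \<open>v\<close> standing for the
  squared length.\<close>

lemma sums_integral_power_series:
  fixes q \<psi> :: "'a \<Rightarrow> real"
  assumes \<psi>: "integrable M \<psi>" and q: "q \<in> borel_measurable M"
    and Q: "\<And>x. x \<in> space M \<Longrightarrow> \<bar>q x\<bar> \<le> Q"
    and summ: "summable (\<lambda>n. \<bar>c n\<bar> * (\<bar>v\<bar> * Q) ^ n)"
  shows "(\<lambda>n. c n * (\<integral>x. q x ^ n * \<psi> x \<partial>M) * v ^ n) sums
    (\<integral>x. (\<Sum>n. c n * (v * q x) ^ n) * \<psi> x \<partial>M)"
proof -
  let ?f = "\<lambda>n x. (c n * (v * q x) ^ n) * \<psi> x"
  have le: "\<bar>?f n x\<bar> \<le> \<bar>c n\<bar> * (\<bar>v\<bar> * Q) ^ n * \<bar>\<psi> x\<bar>" if "x \<in> space M" for n x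
    using Q[OF that] unfolding abs_mult power_abs
    by (intro mult_right_mono mult_left_mono power_mono) auto
  have int: "integrable M (?f n)" for n
  proof (rule Bochner_Integration.integrable_bound)
    show "integrable M (\<lambda>x. \<bar>c n\<bar> * (\<bar>v\<bar> * Q) ^ n * \<bar>\<psi> x\<bar>)"
      using \<psi> by simp
    show "?f n \<in> borel_measurable M"
      using \<psi> q by measurable
    show "AE x in M. norm (?f n x) \<le> norm (\<bar>c n\<bar> * (\<bar>v\<bar> * Q) ^ n * \<bar>\<psi> x\<bar>)"
      using le by (intro AE_I2) (force intro: order_trans[OF _ abs_ge_self])
  qed
  have "(\<lambda>n. \<integral>x. ?f n x \<partial>M) sums (\<integral>x. (\<Sum>n. ?f n x) \<partial>M)"
  proof (rule sums_integral[OF int])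
    show "AE x in M. summable (\<lambda>n. norm (?f n x))"
      using le
      by (intro AE_I2 summable_comparison_test'[OF summable_mult2[OF summ]]) auto
    have "summable (\<lambda>n. \<bar>c n\<bar> * (\<bar>v\<bar> * Q) ^ n * (\<integral>x. \<bar>\<psi> x\<bar> \<partial>M))"
      by (rule summable_mult2[OF summ])
    then show "summable (\<lambda>n. \<integral>x. norm (?f n x) \<partial>M)"
    proof (rule summable_comparison_test')
      fix n
      have "(\<integral>x. norm (?f n x) \<partial>M) \<le> (\<integral>x. \<bar>c n\<bar> * (\<bar>v\<bar> * Q) ^ n * \<bar>\<psi> x\<bar> \<partial>M)"
        using int[of n] \<psi> le by (intro integral_mono) auto
      then show "norm (\<integral>x. norm (?f n x) \<partial>M) \<le> \<bar>c n\<bar> * (\<bar>v\<bar> * Q) ^ n * (\<integral>x. \<bar>\<psi> x\<bar> \<partial>M)"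
        by simp
    qed
  qed
  moreover have "(\<integral>x. ?f n x \<partial>M) = c n * (\<integral>x. q x ^ n * \<psi> x \<partial>M) * v ^ n" for n
  proof -
    have "(\<integral>x. ?f n x \<partial>M) = (\<integral>x. (c n * v ^ n) * (q x ^ n * \<psi> x) \<partial>M)"
      by (intro Bochner_Integration.integral_cong) (auto simp: power_mult_distrib)
    then show ?thesis by simp
  qed
  moreover have "(\<integral>x. (\<Sum>n. ?f n x) \<partial>M) = (\<integral>x. (\<Sum>n. c n * (v * q x) ^ n) * \<psi> x \<partial>M)"
  proof (intro Bochner_Integration.integral_cong refl)
    fix x assume x: "x \<in> space M"
    have "summable (\<lambda>n. c n * (v * q x) ^ n)"
    proof (rule summable_comparison_test'[OF summ])
      fix n show "norm (c n * (v * q x) ^ n) \<le> \<bar>c n\<bar> * (\<bar>v\<bar> * Q) ^ n"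
        using Q[OF x] by (auto simp: abs_mult power_abs intro!: mult_left_mono power_mono)
    qed
    then show "(\<Sum>n. ?f n x) = (\<Sum>n. c n * (v * q x) ^ n) * \<psi> x"
      by (simp add: suminf_mult2)
  qed
  ultimately show ?thesis by simp
qed

section \<open>The truncated square root and its integrals over a finite measure\<close>

lemma sqrt0_sums:
  assumes "\<bar>x\<bar> < 1"
  shows "(\<lambda>n. ((1/2) gchoose n) * (-1) ^ n * x ^ n) sums sqrt0 (1 - x)"
proof -
  have "(\<lambda>n. ((1/2) gchoose n) * (- x) ^ n) sums (1 + (- x)) powr (1/2)"
    using assms by (intro gen_binomial_real) simp
  \<comment> \<open>Here \<open>1 - x > 0\<close>, so the truncation is inactive.\<close>
  moreover have "(1 + (- x)) powr (1/2) = sqrt0 (1 - x)"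
    using assms by (simp add: sqrt0_def powr_half_sqrt)
  moreover have "(- x) ^ n = (-1) ^ n * x ^ n" for n
    by (metis mult_minus1 power_mult_distrib)
  ultimately show ?thesis
    by (simp add: mult.assoc)
qed

lemma continuous_on_sqrt0: "continuous_on UNIV sqrt0"
proof -
  have "sqrt0 = (\<lambda>x. sqrt (max 0 x))"
    by (auto simp: sqrt0_def fun_eq_iff)
  moreover have "continuous_on UNIV (\<lambda>x::real. sqrt (max 0 x))"
    by (intro continuous_intros)
  ultimately show ?thesis
    by metis
qed

lemma sqrt0_measurable [measurable]: "sqrt0 \<in> borel_measurable borel"
  by (rule borel_measurable_continuous_onI[OF continuous_on_sqrt0])

lemma sqrt0_nonneg: "0 \<le> sqrt0 x"
  by (simp add: sqrt0_def)

text \<open>A bound on the whole line: in the continuity proof below the radicand may exceed 1,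
  since the parameter \<open>u\<close> is allowed to be negative.\<close>

lemma sqrt0_le: "sqrt0 x \<le> 1 + \<bar>x\<bar>"
proof (cases "x < 0")
  case False
  then have "sqrt x \<le> sqrt ((1 + x)\<^sup>2)"
    by (intro real_sqrt_le_mono) (simp add: power2_eq_square algebra_simps)
  with False show ?thesis by (simp add: sqrt0_def)
qed (simp add: sqrt0_def)

lemma sqrt0_le_1: "x \<le> 1 \<Longrightarrow> sqrt0 x \<le> 1"
  by (simp add: sqrt0_def)

lemma continuous_on_integral_sqrt0:
  fixes \<alpha> :: "'a \<Rightarrow> real"
  assumes "finite_measure M" and \<alpha>[measurable]: "\<alpha> \<in> borel_measurable M"
    and C: "\<And>x. \<bar>\<alpha> x\<bar> \<le> C"
  shows "continuous_on UNIV (\<lambda>u. \<integral>x. sqrt0 (1 - u * \<alpha> x) \<partial>M)"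
  unfolding continuous_on_sequentially comp_def
proof safe
  interpret finite_measure M by fact
  fix u :: "nat \<Rightarrow> real" and a assume u: "u \<longlonglongrightarrow> a"
  obtain K where K: "\<And>n. \<bar>u n\<bar> \<le> K"
    using convergent_imp_Bseq[OF convergentI[OF u]] by (auto simp: Bseq_def)
  show "(\<lambda>n. \<integral>x. sqrt0 (1 - u n * \<alpha> x) \<partial>M) \<longlonglongrightarrow> (\<integral>x. sqrt0 (1 - a * \<alpha> x) \<partial>M)"
  \<comment> \<open>A convergent sequence is bounded by some \<open>K\<close>, so the radicand is at
    most \<open>1 + K * C\<close> in modulus; \<open>sqrt0_le\<close> adds one more.\<close>
  proof (rule integral_dominated_convergence[where w = "\<lambda>_. 2 + K * C"])
    show "AE x in M. (\<lambda>n. sqrt0 (1 - u n * \<alpha> x)) \<longlonglongrightarrow> sqrt0 (1 - a * \<alpha> x)"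
      by (intro AE_I2 continuous_on_tendsto_compose[OF continuous_on_sqrt0] tendsto_intros u) auto
    show "AE x in M. norm (sqrt0 (1 - u n * \<alpha> x)) \<le> 2 + K * C" for n
    proof (intro AE_I2)
      fix x
      have "\<bar>u n * \<alpha> x\<bar> \<le> K * C"
        unfolding abs_mult using K[of n] C[of x] by (intro mult_mono) auto
      then show "norm (sqrt0 (1 - u n * \<alpha> x)) \<le> 2 + K * C"
        using sqrt0_le[of "1 - u n * \<alpha> x"] sqrt0_nonneg[of "1 - u n * \<alpha> x"] by simp
    qed
  qed auto
qed

text \<open>The binomial series is integrated term by term, which turns the powers of
  \<open>\<alpha>\<close> into its moments. The condition on \<open>u\<close> keeps
  \<open>\<bar>u * \<alpha> x\<bar>\<close> below 1 uniformly in \<open>x\<close>.\<close>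

lemma integral_sqrt0_sums:
  fixes \<alpha> :: "'a \<Rightarrow> real"
  assumes "finite_measure M" and \<alpha>: "\<alpha> \<in> borel_measurable M"
    and C: "\<And>x. \<bar>\<alpha> x\<bar> \<le> C" and u: "\<bar>u\<bar> * C < 1"
  shows "(\<lambda>n. ((1/2) gchoose n) * (-1) ^ n * (\<integral>x. \<alpha> x ^ n \<partial>M) * u ^ n) sums
    (\<integral>x. sqrt0 (1 - u * \<alpha> x) \<partial>M)"
proof -
  interpret finite_measure M by fact
  have C0: "0 \<le> C"
    using C[of undefined] by linarith
  have "(\<lambda>n. ((1/2) gchoose n) * (-1) ^ n * (\<integral>x. \<alpha> x ^ n * 1 \<partial>M) * u ^ n) sums
    (\<integral>x. (\<Sum>n. ((1/2) gchoose n) * (-1) ^ n * (u * \<alpha> x) ^ n) * 1 \<partial>M)"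
  proof (rule sums_integral_power_series[where Q = C])
    have "summable (\<lambda>n. (\<bar>u\<bar> * C) ^ n)"
      using u C0 by (intro summable_geometric) (simp add: abs_mult)
    then show "summable (\<lambda>n. \<bar>((1/2) gchoose n) * (-1) ^ n\<bar> * (\<bar>u\<bar> * C) ^ n)"
      by (rule summable_comparison_test'[where N = 0])
         (use C0 abs_gbinomial_half_le_1 in \<open>auto simp: abs_mult intro!: mult_left_le_one_le\<close>)
  qed (use \<alpha> C in auto)
  moreover have "(\<Sum>n. ((1/2) gchoose n) * (-1) ^ n * (u * \<alpha> x) ^ n) = sqrt0 (1 - u * \<alpha> x)" for x
  proof -
    have "\<bar>u * \<alpha> x\<bar> \<le> \<bar>u\<bar> * C"
      unfolding abs_mult using C by (intro mult_left_mono) auto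
    then show ?thesis
      using u sums_unique[OF sqrt0_sums[of "u * \<alpha> x"]] by simp
  qed
  ultimately show ?thesis by simp
qed

subsection \<open>The kernel\<close>

text \<open>This is the uniform distribution on the unit sphere in spherical coordinates. As a
  single measure on the plane it lets the lemmas on finite measures apply to the iterated integral
  of the kernel. The indicators also remove the range where the sine is negative.\<close>

definition spheroid_measure :: "(real \<times> real) measure" where
  "spheroid_measure = density (lborel \<Otimes>\<^sub>M lborel)
     (\<lambda>(\<phi>, \<theta>). indicator {0..2*pi} \<phi> * indicator {0..pi} \<theta> * (sin \<theta> / (4*pi)))"

lemma spheroid_weight_measurable [measurable]:
  "(\<lambda>(\<phi>, \<theta>). indicator {0..2*pi} \<phi> * indicator {0..pi} \<theta> * (sin \<theta> / (4*pi)))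
    \<in> borel_measurable (lborel \<Otimes>\<^sub>M lborel :: (real \<times> real) measure)"
  by measurable

lemma space_spheroid_measure [simp]: "space spheroid_measure = UNIV"
  by (simp add: spheroid_measure_def space_pair_measure)

lemma sets_spheroid_measure [measurable_cong]:
  "sets spheroid_measure = sets (borel \<Otimes>\<^sub>M borel)"
  by (simp add: spheroid_measure_def sets_pair_measure_cong[OF sets_lborel sets_lborel])

text \<open>The inner integral is \<open>1 / (2*pi)\<close> and the outer interval has length
  \<open>2*pi\<close>. Total mass one is what cancels the constant term of the kernel.\<close>

lemma emeasure_spheroid_measure: "emeasure spheroid_measure UNIV = 1"
proof -
  have *: "(\<integral>\<^sup>+\<theta>. ennreal (sin \<theta> / (4*pi)) * indicator {0..pi} \<theta> \<partial>lborel) =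
      ennreal (- cos pi / (4*pi) - (- cos 0 / (4*pi)))"
    by (rule nn_integral_FTC_Icc[where F = "\<lambda>\<theta>. - cos \<theta> / (4*pi)"])
       (auto simp: sin_ge_zero intro!: derivative_eq_intros)
  have "emeasure spheroid_measure UNIV = (\<integral>\<^sup>+p. ennreal (case p of (\<phi>, \<theta>) \<Rightarrow>
      indicator {0..2*pi} \<phi> * indicator {0..pi} \<theta> * (sin \<theta> / (4*pi))) \<partial>(lborel \<Otimes>\<^sub>M lborel))"
    unfolding spheroid_measure_def
    using sets.top[of "lborel \<Otimes>\<^sub>M lborel :: (real \<times> real) measure"]
    by (subst emeasure_density) (auto simp: space_pair_measure)
  also have "\<dots> = (\<integral>\<^sup>+\<phi>. \<integral>\<^sup>+\<theta>. ennreal (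
      indicator {0..2*pi} \<phi> * indicator {0..pi} \<theta> * (sin \<theta> / (4*pi))) \<partial>lborel \<partial>lborel)"
    by (subst lborel.nn_integral_fst[symmetric]) auto
  also have "\<dots> = (\<integral>\<^sup>+\<phi>. indicator {0..2*pi} \<phi> * (\<integral>\<^sup>+\<theta>. ennreal (sin \<theta> / (4*pi)) * indicator {0..pi} \<theta> \<partial>lborel) \<partial>lborel)"
    by (intro nn_integral_cong) (auto simp: indicator_def intro!: nn_integral_cong)
  also have "\<dots> = 1"
    unfolding * by (simp add: nn_integral_multc ennreal_mult[symmetric])
  finally show ?thesis .
qed

lemma finite_measure_spheroid_measure: "finite_measure spheroid_measure"
  by (rule finite_measureI) (simp add: emeasure_spheroid_measure)

lemma measure_spheroid_measure [simp]: "measure spheroid_measure UNIV = 1"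
  by (simp add: measure_def emeasure_spheroid_measure)

text \<open>Fubini's theorem; a bounded function is integrable because the measure is
  finite.\<close>

lemma integral_spheroid_measure:
  fixes g :: "real \<times> real \<Rightarrow> real"
  assumes g: "g \<in> borel_measurable (borel \<Otimes>\<^sub>M borel)" and B: "\<And>p. \<bar>g p\<bar> \<le> B"
  shows "(\<integral>p. g p \<partial>spheroid_measure) =
    (LBINT \<phi>:{0..2*pi}. (LBINT \<theta>:{0..pi}. g (\<phi>, \<theta>) * (sin \<theta> / (4*pi))))"
proof -
  interpret finite_measure spheroid_measure by (rule finite_measure_spheroid_measure)
  let ?w = "\<lambda>(\<phi>, \<theta>). indicator {0..2*pi} \<phi> * indicator {0..pi} \<theta> * (sin \<theta> / (4*pi)) :: real"
  have gm: "g \<in> borel_measurable (lborel \<Otimes>\<^sub>M lborel)"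
    using g by (simp add: measurable_def sets_pair_measure_cong[OF sets_lborel sets_lborel] space_pair_measure)
  have w0: "0 \<le> ?w p" for p
    by (auto simp: indicator_def sin_ge_zero split: prod.splits)
  have "integrable spheroid_measure g"
    using B g by (intro integrable_const_bound[of _ B]) (auto simp: measurable_cong_sets[OF sets_spheroid_measure])
  then have int: "integrable (lborel \<Otimes>\<^sub>M lborel) (\<lambda>p. ?w p *\<^sub>R g p)"
    unfolding spheroid_measure_def using gm w0 by (subst (asm) integrable_density) auto
  have "(\<integral>p. g p \<partial>spheroid_measure) = (\<integral>p. ?w p *\<^sub>R g p \<partial>(lborel \<Otimes>\<^sub>M lborel))"
    unfolding spheroid_measure_def using gm w0 by (subst integral_density) auto
  also have "\<dots> = (\<integral>\<phi>. \<integral>\<theta>. ?w (\<phi>, \<theta>) *\<^sub>R g (\<phi>, \<theta>) \<partial>lborel \<partial>lborel)"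
    using lborel_pair.integral_fst'[OF int] by simp
  also have "\<dots> = (\<integral>\<phi>. indicator {0..2*pi} \<phi> *\<^sub>R
      (\<integral>\<theta>. indicator {0..pi} \<theta> *\<^sub>R (g (\<phi>, \<theta>) * (sin \<theta> / (4*pi))) \<partial>lborel) \<partial>lborel)"
    by (intro Bochner_Integration.integral_cong refl) (auto simp: indicator_def mult_ac intro!: Bochner_Integration.integral_cong)
  finally show ?thesis
    by (simp add: set_lebesgue_integral_def)
qed

section \<open>Bounds on \<alpha>\<close>

lemma spheroid_denominator_pos:
  fixes \<eta> :: real
  assumes "\<eta> > 0"
  shows "(cos \<theta>)\<^sup>2 + \<eta>\<^sup>2 * (sin \<theta>)\<^sup>2 > 0"
proof (cases "sin \<theta> = 0")
  case True
  then show ?thesis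
    using sin_cos_squared_add[of \<theta>] by simp
next
  case False
  then show ?thesis
    using assms by (intro add_nonneg_pos) auto
qed

text \<open>With \<open>D\<close> for the denominator, \<alpha> is a convex combination of
  \<open>1 / D\<close> and 1 with weights \<open>(cos \<phi>)\<^sup>2\<close> and
  \<open>(sin \<phi>)\<^sup>2\<close>. The constants are chosen to cover both
  \<open>\<eta> < 1\<close> and \<open>\<eta> \<ge> 1\<close> without a case distinction. The lower
  one keeps the moments positive, the upper one fixes the radius of convergence.\<close>

lemma spheroid_alpha_bounds:
  assumes \<eta>: "\<eta> > 0"
  shows "1 / (1 + \<eta>\<^sup>2) \<le> spheroid_alpha \<eta> \<phi> \<theta>"
    and "spheroid_alpha \<eta> \<phi> \<theta> \<le> (1 + \<eta>\<^sup>2) / \<eta>\<^sup>2"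
proof -
  define D where "D = (cos \<theta>)\<^sup>2 + \<eta>\<^sup>2 * (sin \<theta>)\<^sup>2"
  have D: "D > 0"
    unfolding D_def by (rule spheroid_denominator_pos[OF \<eta>])
  have e: "\<eta>\<^sup>2 > 0" using \<eta> by simp
  have c: "(cos \<theta>)\<^sup>2 = 1 - (sin \<theta>)\<^sup>2"
    using sin_cos_squared_add[of \<theta>] by linarith
  have s: "0 \<le> (sin \<theta>)\<^sup>2" "(sin \<theta>)\<^sup>2 \<le> 1"
    by (simp_all add: abs_square_le_1)
  have "\<eta>\<^sup>2 * (sin \<theta>)\<^sup>2 \<le> \<eta>\<^sup>2 * 1"
    using s e by (intro mult_left_mono) auto
  then have "D \<le> 1 + \<eta>\<^sup>2"
    unfolding D_def c using s(1) by linarith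
  then have lo: "1 / (1 + \<eta>\<^sup>2) \<le> 1 / D"
    using D by (intro divide_left_mono) auto
  \<comment> \<open>The two mixed terms in \<open>\<eta>\<^sup>2 * (sin \<theta>)\<^sup>2\<close>
    cancel, and what remains beside \<open>\<eta>\<^sup>2\<close> is nonnegative.\<close>
  have "(1 + \<eta>\<^sup>2) * D = \<eta>\<^sup>2 + (1 - (sin \<theta>)\<^sup>2) + \<eta>\<^sup>2 * (\<eta>\<^sup>2 * (sin \<theta>)\<^sup>2)"
    unfolding D_def c by (simp add: algebra_simps)
  moreover have "0 \<le> \<eta>\<^sup>2 * (\<eta>\<^sup>2 * (sin \<theta>)\<^sup>2)"
    by simp
  ultimately have "\<eta>\<^sup>2 \<le> (1 + \<eta>\<^sup>2) * D"
    using s(2) by linarith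
  then have hi: "1 / D \<le> (1 + \<eta>\<^sup>2) / \<eta>\<^sup>2"
    using D e by (simp add: field_simps)
  have a: "spheroid_alpha \<eta> \<phi> \<theta> = (cos \<phi>)\<^sup>2 * (1 / D) + (sin \<phi>)\<^sup>2 * 1"
    by (simp add: spheroid_alpha_def D_def)
  have cs: "(cos \<phi>)\<^sup>2 * x + (sin \<phi>)\<^sup>2 * x = x" for x
    by (metis distrib_right mult_1 sin_cos_squared_add2)
  have one: "1 / (1 + \<eta>\<^sup>2) \<le> 1"
    by (rule divide_le_eq_1[THEN iffD2]) (use e in linarith)
  have "(cos \<phi>)\<^sup>2 * (1 / (1 + \<eta>\<^sup>2)) + (sin \<phi>)\<^sup>2 * (1 / (1 + \<eta>\<^sup>2)) \<le> spheroid_alpha \<eta> \<phi> \<theta>"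
    unfolding a using lo one by (intro add_mono mult_left_mono) auto
  then show "1 / (1 + \<eta>\<^sup>2) \<le> spheroid_alpha \<eta> \<phi> \<theta>"
    unfolding cs .
  have "spheroid_alpha \<eta> \<phi> \<theta> \<le>
      (cos \<phi>)\<^sup>2 * ((1 + \<eta>\<^sup>2) / \<eta>\<^sup>2) + (sin \<phi>)\<^sup>2 * ((1 + \<eta>\<^sup>2) / \<eta>\<^sup>2)"
    unfolding a using hi e by (intro add_mono mult_left_mono) auto
  then show "spheroid_alpha \<eta> \<phi> \<theta> \<le> (1 + \<eta>\<^sup>2) / \<eta>\<^sup>2"
    unfolding cs .
qed

lemma spheroid_alpha_measurable:
  "(\<lambda>p. spheroid_alpha \<eta> (fst p) (snd p)) \<in> borel_measurable (borel \<Otimes>\<^sub>M borel)"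
  unfolding spheroid_alpha_def by measurable

text \<open>The kernel depends on \<open>l\<close> and \<open>r\<close> only through
  \<open>u = (l / (2*r))\<^sup>2\<close>. Continuity in this one variable yields both continuity in
  \<open>l\<close> and measurability in \<open>r\<close>.\<close>

definition chord_profile :: "real \<Rightarrow> real \<Rightarrow> real" where
  "chord_profile \<eta> u = (\<integral>p. sqrt0 (1 - u * spheroid_alpha \<eta> (fst p) (snd p)) \<partial>spheroid_measure)"

lemma spheroid_alpha_pos:
  assumes "\<eta> > 0"
  shows "spheroid_alpha \<eta> \<phi> \<theta> > 0"
proof (rule less_le_trans[OF _ spheroid_alpha_bounds(1)[OF assms]])
  show "0 < 1 / (1 + \<eta>\<^sup>2)"
    by (simp add: add_pos_nonneg)
qed

lemma continuous_on_chord_profile: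
  assumes "\<eta> > 0"
  shows "continuous_on UNIV (chord_profile \<eta>)"
proof -
  have "\<bar>spheroid_alpha \<eta> (fst p) (snd p)\<bar> \<le> (1 + \<eta>\<^sup>2) / \<eta>\<^sup>2" for p
    using spheroid_alpha_bounds(2)[OF assms] spheroid_alpha_pos[OF assms]
    by (simp add: abs_of_pos)
  then show ?thesis
    unfolding chord_profile_def
    using spheroid_alpha_measurable[of \<eta>]
    by (intro continuous_on_integral_sqrt0 finite_measure_spheroid_measure)
       (simp add: measurable_cong_sets[OF sets_spheroid_measure refl])
qed

lemma chord_integrand_measurable:
  "(\<lambda>p. sqrt0 (1 - u * spheroid_alpha \<eta> (fst p) (snd p))) \<in> borel_measurable (borel \<Otimes>\<^sub>M borel)"
  using spheroid_alpha_measurable[of \<eta>] by measurable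

lemma chord_integrand_bounds:
  assumes "\<eta> > 0" "u \<ge> 0"
  shows "0 \<le> sqrt0 (1 - u * spheroid_alpha \<eta> \<phi> \<theta>)" "sqrt0 (1 - u * spheroid_alpha \<eta> \<phi> \<theta>) \<le> 1"
  using spheroid_alpha_pos[OF assms(1), of \<phi> \<theta>] assms(2)
  by (auto intro!: sqrt0_nonneg sqrt0_le_1)

lemma spheroid_kernel_eq:
  assumes "\<eta> > 0"
  shows "spheroid_kernel \<eta> l r = 1 - chord_profile \<eta> ((l / (2*r))\<^sup>2)"
  unfolding spheroid_kernel_def chord_profile_def
  using chord_integrand_bounds[OF assms, of "(l / (2*r))\<^sup>2"]
  by (subst integral_spheroid_measure[OF chord_integrand_measurable, of _ _ 1]) auto

lemma chord_profile_bounds: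
  assumes "\<eta> > 0" "u \<ge> 0"
  shows "0 \<le> chord_profile \<eta> u" "chord_profile \<eta> u \<le> 1"
proof -
  interpret finite_measure spheroid_measure by (rule finite_measure_spheroid_measure)
  show "0 \<le> chord_profile \<eta> u"
    unfolding chord_profile_def by (intro integral_nonneg_AE AE_I2 sqrt0_nonneg)
  have "chord_profile \<eta> u \<le> (\<integral>p. 1 \<partial>spheroid_measure)"
    unfolding chord_profile_def using chord_integrand_bounds[OF assms] chord_integrand_measurable[of u \<eta>]
    by (intro integral_mono integrable_const_bound[where B = 1])
       (auto simp: measurable_cong_sets[OF sets_spheroid_measure refl])
  then show "chord_profile \<eta> u \<le> 1" by simp
qed

lemma spheroid_kernel_bounds:
  assumes "\<eta> > 0"
  shows "0 \<le> spheroid_kernel \<eta> l r" "spheroid_kernel \<eta> l r \<le> 1"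
  unfolding spheroid_kernel_eq[OF assms] using chord_profile_bounds[OF assms] by auto

lemma continuous_on_spheroid_kernel:
  assumes "\<eta> > 0"
  shows "continuous_on UNIV (\<lambda>l. spheroid_kernel \<eta> l r)"
proof -
  have "continuous_on UNIV (\<lambda>l. (l / (2*r))\<^sup>2)"
    \<comment> \<open>As a product with a constant inverse the map is continuous for every
      \<open>r\<close>, including \<open>r = 0\<close>.\<close>
    unfolding divide_inverse
    by (intro continuous_on_power continuous_on_mult continuous_on_id continuous_on_const)
  then show ?thesis
    unfolding spheroid_kernel_eq[OF assms]
    by (intro continuous_on_diff continuous_on_const
        continuous_on_compose2[OF continuous_on_chord_profile[OF assms]]) auto
qed

lemma spheroid_kernel_measurable:
  assumes "\<eta> > 0"
  shows "spheroid_kernel \<eta> l \<in> borel_measurable (lebesgue_on S)"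
proof -
  have [measurable]: "chord_profile \<eta> \<in> borel_measurable borel"
    by (rule borel_measurable_continuous_onI[OF continuous_on_chord_profile[OF assms]])
  have "(\<lambda>r. 1 - chord_profile \<eta> ((l / (2*r))\<^sup>2)) \<in> borel_measurable borel"
    by measurable
  then have "spheroid_kernel \<eta> l \<in> borel_measurable borel"
    by (simp add: spheroid_kernel_eq[OF assms, abs_def])
  then show ?thesis
    by (intro measurable_restrict_space1 measurable_completion) simp
qed

subsection \<open>The transform\<close>

lemma finite_measure_lebesgue_on_Ioo: "finite_measure (lebesgue_on {a<..<b::real})"
  using lmeasurable_box[of a b] by (intro finite_measure_lebesgue_on) simp

text \<open>On an interval of finite length, square integrability implies integrability. Since the
  kernel is bounded, the estimates on the transform need only the latter.\<close>

lemma integrable_if_square_integrable: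
  assumes "f \<in> square_integrable a b"
  shows "integrable (lebesgue_on {a<..<b}) f"
  using assms finite_measure.square_integrable_imp_integrable[OF finite_measure_lebesgue_on_Ioo]
  by (auto simp: square_integrable_def)

lemma integrable_spheroid_kernel_mult:
  assumes \<eta>: "\<eta> > 0" and \<psi>: "integrable (lebesgue_on S) \<psi>"
  shows "integrable (lebesgue_on S) (\<lambda>r. spheroid_kernel \<eta> l r * \<psi> r)"
proof (rule Bochner_Integration.integrable_bound[OF \<psi>])
  show "(\<lambda>r. spheroid_kernel \<eta> l r * \<psi> r) \<in> borel_measurable (lebesgue_on S)"
    using spheroid_kernel_measurable[OF \<eta>] \<psi> by auto
  show "AE r in lebesgue_on S. norm (spheroid_kernel \<eta> l r * \<psi> r) \<le> norm (\<psi> r)"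
    using spheroid_kernel_bounds[OF \<eta>] by (auto simp: abs_mult intro!: mult_left_le_one_le)
qed

text \<open>The kernel lies between 0 and 1, so \<open>\<bar>\<psi> r\<bar>\<close> dominates for
  all \<open>l\<close>. Continuity is what makes the transform measurable.\<close>

lemma continuous_on_spheroid_transform:
  assumes \<eta>: "\<eta> > 0" and \<psi>: "integrable (lebesgue_on {a<..<b}) \<psi>"
  shows "continuous_on UNIV (spheroid_transform \<eta> a b \<psi>)"
  unfolding continuous_on_sequentially comp_def spheroid_transform_def
proof safe
  let ?N = "lebesgue_on {a<..<b}"
  fix u :: "nat \<Rightarrow> real" and l assume u: "u \<longlonglongrightarrow> l"
  show "(\<lambda>n. \<integral>r. spheroid_kernel \<eta> (u n) r * \<psi> r \<partial>?N) \<longlonglongrightarrow> (\<integral>r. spheroid_kernel \<eta> l r * \<psi> r \<partial>?N)"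
  proof (rule integral_dominated_convergence[where w = "\<lambda>r. \<bar>\<psi> r\<bar>"])
    show "AE r in ?N. (\<lambda>n. spheroid_kernel \<eta> (u n) r * \<psi> r) \<longlonglongrightarrow> spheroid_kernel \<eta> l r * \<psi> r"
      by (intro AE_I2 tendsto_intros continuous_on_tendsto_compose[OF continuous_on_spheroid_kernel[OF \<eta>] u]) auto
    show "AE r in ?N. norm (spheroid_kernel \<eta> (u n) r * \<psi> r) \<le> \<bar>\<psi> r\<bar>" for n
      using spheroid_kernel_bounds[OF \<eta>] by (auto simp: abs_mult intro!: mult_left_le_one_le)
  qed (use \<psi> integrable_spheroid_kernel_mult[OF \<eta> \<psi>] in auto)
qed

text \<open>The transform is bounded by the integral of \<open>\<bar>\<psi> r\<bar>\<close>, and a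
  bounded measurable function is square-integrable on a bounded interval.\<close>

lemma spheroid_transform_square_integrable:
  assumes \<eta>: "\<eta> > 0" and \<psi>: "\<psi> \<in> square_integrable a b"
  shows "spheroid_transform \<eta> a b \<psi> \<in> square_integrable c d"
proof -
  let ?N = "lebesgue_on {a<..<b}" and ?T = "spheroid_transform \<eta> a b \<psi>"
  interpret finite_measure "lebesgue_on {c<..<d}" by (rule finite_measure_lebesgue_on_Ioo)
  note \<psi>i = integrable_if_square_integrable[OF \<psi>]
  have meas: "?T \<in> borel_measurable (lebesgue_on {c<..<d})"
    by (intro continuous_imp_measurable_on_sets_lebesgue
        continuous_on_subset[OF continuous_on_spheroid_transform[OF \<eta> \<psi>i]]) auto
  have bound: "\<bar>?T l\<bar> \<le> (\<integral>r. \<bar>\<psi> r\<bar> \<partial>?N)" for l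
  proof -
    have "\<bar>?T l\<bar> \<le> (\<integral>r. \<bar>spheroid_kernel \<eta> l r * \<psi> r\<bar> \<partial>?N)"
      unfolding spheroid_transform_def by (rule integral_abs_bound)
    also have "\<dots> \<le> (\<integral>r. \<bar>\<psi> r\<bar> \<partial>?N)"
      using spheroid_kernel_bounds[OF \<eta>]
      by (intro integral_mono integrable_abs integrable_spheroid_kernel_mult[OF \<eta>] \<psi>i)
         (auto simp: abs_mult intro!: mult_left_le_one_le)
    finally show ?thesis .
  qed
  have "norm ((?T l)\<^sup>2) \<le> (\<integral>r. \<bar>\<psi> r\<bar> \<partial>?N)\<^sup>2" for l
    using power_mono[OF bound abs_ge_zero, of l 2] by simp
  then have "integrable (lebesgue_on {c<..<d}) (\<lambda>l. (?T l)\<^sup>2)"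
    using meas
    by (intro integrable_const_bound[where B = "(\<integral>r. \<bar>\<psi> r\<bar> \<partial>?N)\<^sup>2"] AE_I2) simp_all
  with meas show ?thesis
    by (simp add: square_integrable_def)
qed

section \<open>Recovery of \<psi> from a vanishing transform\<close>

lemma chord_profile_sums:
  assumes \<eta>: "\<eta> > 0" and u: "\<bar>u\<bar> * ((1 + \<eta>\<^sup>2) / \<eta>\<^sup>2) < 1"
  shows "(\<lambda>n. ((1/2) gchoose n) * (-1) ^ n *
      (\<integral>p. spheroid_alpha \<eta> (fst p) (snd p) ^ n \<partial>spheroid_measure) * u ^ n) sums chord_profile \<eta> u"
  unfolding chord_profile_def
proof (rule integral_sqrt0_sums[OF finite_measure_spheroid_measure _ _ u])
  show "(\<lambda>p. spheroid_alpha \<eta> (fst p) (snd p)) \<in> borel_measurable spheroid_measure"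
    using spheroid_alpha_measurable[of \<eta>]
    by (simp add: measurable_cong_sets[OF sets_spheroid_measure refl])
  show "\<bar>spheroid_alpha \<eta> (fst p) (snd p)\<bar> \<le> (1 + \<eta>\<^sup>2) / \<eta>\<^sup>2" for p
    using spheroid_alpha_bounds(2)[OF \<eta>, of "fst p" "snd p"] spheroid_alpha_pos[OF \<eta>, of "fst p" "snd p"]
    by simp
qed

lemma spheroid_alpha_moment_pos:
  assumes \<eta>: "\<eta> > 0"
  shows "(\<integral>p. spheroid_alpha \<eta> (fst p) (snd p) ^ n \<partial>spheroid_measure) > 0"
proof -
  interpret finite_measure spheroid_measure by (rule finite_measure_spheroid_measure)
  let ?\<alpha> = "\<lambda>p. spheroid_alpha \<eta> (fst p) (snd p)"
  have lo: "0 < 1 / (1 + \<eta>\<^sup>2)"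
    by (simp add: add_pos_nonneg)
  have "(1 / (1 + \<eta>\<^sup>2)) ^ n = (\<integral>p. (1 / (1 + \<eta>\<^sup>2)) ^ n \<partial>spheroid_measure)"
    by simp
  also have "\<dots> \<le> (\<integral>p. ?\<alpha> p ^ n \<partial>spheroid_measure)"
  proof (rule integral_mono)
    show "integrable spheroid_measure (\<lambda>p. ?\<alpha> p ^ n)"
    proof (rule integrable_const_bound)
      show "(\<lambda>p. ?\<alpha> p ^ n) \<in> borel_measurable spheroid_measure"
        using spheroid_alpha_measurable[of \<eta>]
        by (simp add: measurable_cong_sets[OF sets_spheroid_measure refl])
      show "AE p in spheroid_measure. norm (?\<alpha> p ^ n) \<le> ((1 + \<eta>\<^sup>2) / \<eta>\<^sup>2) ^ n"
        using spheroid_alpha_bounds(2)[OF \<eta>] spheroid_alpha_pos[OF \<eta>]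
        by (auto simp: norm_power less_imp_le intro!: power_mono)
    qed
    show "(1 / (1 + \<eta>\<^sup>2)) ^ n \<le> ?\<alpha> p ^ n" for p
      using spheroid_alpha_bounds(1)[OF \<eta>] lo by (intro power_mono) auto
  qed simp
  finally show ?thesis
    using zero_less_power[OF lo, of n] by linarith
qed

text \<open>Otherwise the interval \<open>{0<..<min L \<delta>}\<close>, of positive length, would
  be null.\<close>

lemma AE_lebesgue_on_Ioo_imp_ex:
  fixes L \<delta> :: real
  assumes "AE x in lebesgue_on {0<..<L}. P x" "0 < L" "0 < \<delta>"
  shows "\<exists>x. 0 < x \<and> x < \<delta> \<and> P x"
proof (rule ccontr)
  assume no: "\<not> ?thesis"
  have "AE x in lebesgue. x \<in> {0<..<L} \<longrightarrow> P x"
    using assms(1) by (subst (asm) AE_restrict_space_iff) auto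
  then have "AE x in lebesgue. x \<notin> {0<..<min L \<delta>}"
    by eventually_elim (use no in auto)
  then have "emeasure lebesgue {0<..<min L \<delta>} = 0"
    by (subst (asm) AE_iff_measurable[where N = "{0<..<min L \<delta>}"]) auto
  then show False
    using assms(2,3) by simp
qed

text \<open>A single nonzero moment would give the series in \<open>v = l\<^sup>2\<close> a nonzero
  coefficient, making 0 an isolated zero of \<open>H\<close>; but the transform vanishes at
  arbitrarily small positive \<open>l\<close>.\<close>

lemma spheroid_transform_eq_0_imp_moments_eq_0:
  assumes \<eta>: "\<eta> > 0" and a: "0 < a" and L: "0 < L"
    and \<psi>: "integrable (lebesgue_on {a<..<b}) \<psi>"
    and zero: "AE l in lebesgue_on {0<..<L}. spheroid_transform \<eta> a b \<psi> l = 0"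
    and n: "n > 0"
  shows "(\<integral>r. (1 / (2*r)\<^sup>2) ^ n * \<psi> r \<partial>lebesgue_on {a<..<b}) = 0"
proof (rule ccontr)
  assume nz: "\<not> ?thesis"
  let ?N = "lebesgue_on {a<..<b}"
  define q where "q r = 1 / (2*r)\<^sup>2" for r :: real
  define Q where "Q = 1 / (2*a)\<^sup>2"
  define C where "C = (1 + \<eta>\<^sup>2) / \<eta>\<^sup>2"
  define m where "m n = (\<integral>p. spheroid_alpha \<eta> (fst p) (snd p) ^ n \<partial>spheroid_measure)" for n
  \<comment> \<open>These are the Taylor coefficients at 0 of
    \<open>1 - chord_profile \<eta> u\<close>. Since \<open>m 0 = 1\<close>, the one of index 0 is
    zero, which is why \<open>n > 0\<close> is assumed.\<close>
  define \<gamma> where "\<gamma> n = (if n = 0 then 1 else 0) - ((1/2) gchoose n) * (-1) ^ n * m n" for n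
  define H where "H v = (\<integral>r. (1 - chord_profile \<eta> (v * q r)) * \<psi> r \<partial>?N)" for v
  have Q: "Q > 0" using a by (simp add: Q_def)
  have C: "C > 0" using \<eta> by (simp add: C_def add_pos_nonneg)
  have \<gamma>_sums: "(\<lambda>n. \<gamma> n * u ^ n) sums (1 - chord_profile \<eta> u)" if "\<bar>u\<bar> * C < 1" for u
  proof -
    have "(\<lambda>n. (if n = 0 then 1 else 0) * u ^ n) sums 1"
      using sums_finite[of "{0}" "\<lambda>n. (if n = 0 then 1 else 0) * u ^ n"] by simp
    from sums_diff[OF this chord_profile_sums[OF \<eta> that[unfolded C_def]]]
    show ?thesis
      by (simp add: \<gamma>_def m_def left_diff_distrib)
  qed
  have qQ: "\<bar>q r\<bar> \<le> Q" if "r \<in> {a<..<b}" for r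
    unfolding q_def Q_def using that a by (auto intro!: divide_left_mono power_mono)
  have H_sums: "(\<lambda>n. (\<gamma> n * (\<integral>r. q r ^ n * \<psi> r \<partial>?N)) * v ^ n) sums H v"
    if v: "\<bar>v\<bar> < 1 / (Q * C)" for v
  proof -
    have vQ: "\<bar>v\<bar> * Q < 1 / C"
      using v Q C by (simp add: field_simps)
    \<comment> \<open>Convergence at the larger point \<open>x\<close> gives absolute convergence at
      \<open>\<bar>v\<bar> * Q\<close>, as the exchange of sum and integral requires.\<close>
    obtain x where "\<bar>v\<bar> * Q < x" "x < 1 / C"
      using dense[OF vQ] by blast
    with Q have x: "\<bar>v\<bar> * Q < x" "x < 1 / C" "0 \<le> \<bar>v\<bar> * Q"
      by simp_all
    have "summable (\<lambda>n. \<gamma> n * x ^ n)"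
      using x C by (intro sums_summable[OF \<gamma>_sums]) (auto simp: field_simps)
    then have "summable (\<lambda>n. norm (\<gamma> n * (\<bar>v\<bar> * Q) ^ n))"
      by (rule powser_insidea) (use x in auto)
    then have summ: "summable (\<lambda>n. \<bar>\<gamma> n\<bar> * (\<bar>v\<bar> * Q) ^ n)"
      using Q by (simp add: abs_mult)
    have qm: "q \<in> borel_measurable ?N"
      unfolding q_def using a
      by (intro continuous_imp_measurable_on_sets_lebesgue continuous_intros) auto
    have "(\<integral>r. (\<Sum>n. \<gamma> n * (v * q r) ^ n) * \<psi> r \<partial>?N) = H v"
      unfolding H_def
    proof (intro Bochner_Integration.integral_cong refl)
      fix r assume "r \<in> space ?N"
      then have "\<bar>v * q r\<bar> \<le> \<bar>v\<bar> * Q"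
        unfolding abs_mult using qQ[of r] by (intro mult_left_mono) auto
      then have "\<bar>v * q r\<bar> < 1 / C"
        using vQ by linarith
      then have "\<bar>v * q r\<bar> * C < 1"
        using C by (simp add: pos_less_divide_eq)
      from sums_unique[OF \<gamma>_sums[OF this]]
      show "(\<Sum>n. \<gamma> n * (v * q r) ^ n) * \<psi> r = (1 - chord_profile \<eta> (v * q r)) * \<psi> r"
        by simp
    qed
    moreover have "(\<lambda>n. \<gamma> n * (\<integral>r. q r ^ n * \<psi> r \<partial>?N) * v ^ n) sums
        (\<integral>r. (\<Sum>n. \<gamma> n * (v * q r) ^ n) * \<psi> r \<partial>?N)"
      by (rule sums_integral_power_series[OF \<psi> qm _ summ]) (use qQ in simp)
    ultimately show ?thesis
      by simp
  qed
  have HT: "spheroid_transform \<eta> a b \<psi> l = H (l\<^sup>2)" for l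
    unfolding spheroid_transform_def H_def spheroid_kernel_eq[OF \<eta>] q_def
    by (simp add: power_divide)
  have H0: "H 0 = 0"
    unfolding H_def chord_profile_def by (simp add: sqrt0_def)
  have "\<gamma> n \<noteq> 0"
    using n spheroid_alpha_moment_pos[OF \<eta>, of n] by (simp add: \<gamma>_def m_def gbinomial_half_neq_0)
  then have coeff: "\<gamma> n * (\<integral>r. q r ^ n * \<psi> r \<partial>?N) \<noteq> 0"
    using nz by (simp add: q_def)
  \<comment> \<open>Isolation of zeros: \<open>H\<close> is a power series on the disc of radius
    \<open>1 / (Q * C)\<close>, vanishes at 0 and has a nonzero coefficient of positive
    index.\<close>
  obtain s where s: "0 < s" "\<And>z. z \<in> cball 0 s - {0} \<Longrightarrow> H z \<noteq> 0"
    by (rule powser_0_nonzero[of "1 / (Q * C)" 0 "\<lambda>n. \<gamma> n * (\<integral>r. q r ^ n * \<psi> r \<partial>?N)" H n])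
       (use Q C H_sums H0 coeff n in auto)
  obtain l where l: "0 < l" "l < sqrt s" "H (l\<^sup>2) = 0"
    using AE_lebesgue_on_Ioo_imp_ex[OF zero L, of "sqrt s"] s(1) by (auto simp: HT)
  have "l\<^sup>2 < (sqrt s)\<^sup>2"
    using l(1,2) by (intro power_strict_mono) auto
  then have "l\<^sup>2 \<in> cball 0 s - {0}"
    using l(1) s(1) by (simp add: dist_norm)
  from s(2)[OF this] l(3) show False
    by contradiction
qed

text \<open>On \<open>{a..b}\<close> with \<open>a > 0\<close> the function \<open>?q\<close> is
  injective, positive and at most \<open>?q a\<close>. So \<open>?q r * \<psi> r\<close> is
  integrable and vanishes exactly where \<open>\<psi>\<close> does.\<close>

lemma spheroid_transform_eq_0_imp_AE_eq_0:
  assumes \<eta>: "\<eta> > 0" and a: "0 < a" and L: "0 < L"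
    and \<psi>: "integrable (lebesgue_on {a<..<b}) \<psi>"
    and zero: "AE l in lebesgue_on {0<..<L}. spheroid_transform \<eta> a b \<psi> l = 0"
  shows "AE r in lebesgue_on {a<..<b}. \<psi> r = 0"
proof -
  let ?N = "lebesgue_on {a<..<b}"
  let ?q = "\<lambda>r::real. 1 / (2*r)\<^sup>2"
  have q: "continuous_on {a..b} ?q"
    using a by (intro continuous_intros) auto
  have inj: "inj_on ?q {a..b}"
  proof (rule inj_onI)
    fix x y assume xy: "x \<in> {a..b}" "y \<in> {a..b}" "?q x = ?q y"
    then have "(2*x)\<^sup>2 = (2*y)\<^sup>2" using a by simp
    then show "x = y" using xy a by (simp add: power2_eq_iff)
  qed
  have int: "integrable ?N (\<lambda>r. ?q r * \<psi> r)"
  proof (rule Bochner_Integration.integrable_bound)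
    show "integrable ?N (\<lambda>r. ?q a * \<psi> r)" using \<psi> by simp
    have "?q \<in> borel_measurable ?N"
      by (intro continuous_imp_measurable_on_sets_lebesgue continuous_on_subset[OF q]) auto
    then show "(\<lambda>r. ?q r * \<psi> r) \<in> borel_measurable ?N"
      using borel_measurable_integrable[OF \<psi>] by (rule borel_measurable_times)
    have "?q r \<le> ?q a" if "r \<in> {a<..<b}" for r
      using that a by (intro divide_left_mono power_mono) auto
    then show "AE r in ?N. norm (?q r * \<psi> r) \<le> norm (?q a * \<psi> r)"
      by (intro AE_I2) (auto simp only: norm_mult space_restrict_space space_completion space_lborel
          intro!: mult_right_mono norm_ge_zero, auto)
  qed
  \<comment> \<open>The weight \<open>?q\<close> raises the order by one, so even
    \<open>n = 0\<close> calls on a moment of \<open>\<psi>\<close> of positive order.\<close>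
  have "(\<integral>r. ?q r ^ n * (?q r * \<psi> r) \<partial>?N) = 0" for n
    using spheroid_transform_eq_0_imp_moments_eq_0[OF \<eta> a L \<psi> zero, of "Suc n"]
    by (simp add: mult_ac)
  from AE_eq_0_if_moments_eq_0[OF int q inj this]
  have "AE r in ?N. ?q r * \<psi> r = 0" .
  moreover have "AE r in ?N. r \<noteq> 0"
    using a by (intro AE_I2) auto
  ultimately show ?thesis
    by eventually_elim simp
qed

section \<open>Linearity and independence of the representative\<close>

lemma spheroid_transform_add:
  assumes "\<eta> > 0" "f \<in> square_integrable a b" "g \<in> square_integrable a b"
  shows "spheroid_transform \<eta> a b (\<lambda>x. f x + g x) l =
    spheroid_transform \<eta> a b f l + spheroid_transform \<eta> a b g l"
  unfolding spheroid_transform_def distrib_left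
  by (intro Bochner_Integration.integral_add integrable_spheroid_kernel_mult
      integrable_if_square_integrable assms)

lemma spheroid_transform_scale:
  "spheroid_transform \<eta> a b (\<lambda>x. t * f x) l = t * spheroid_transform \<eta> a b f l"
  unfolding spheroid_transform_def by (simp add: mult.left_commute)

text \<open>Changing \<open>\<psi>\<close> on a null set changes none of the integrals, so the
  transforms agree at every \<open>l\<close>, not merely at almost every one.\<close>

lemma spheroid_transform_cong_AE:
  assumes \<eta>: "\<eta> > 0" and fg: "(f, g) \<in> ae_rel a b"
  shows "spheroid_transform \<eta> a b f = spheroid_transform \<eta> a b g"
proof
  fix l
  have f: "integrable (lebesgue_on {a<..<b}) f" and g: "integrable (lebesgue_on {a<..<b}) g"
    and e: "AE x in lebesgue_on {a<..<b}. f x = g x"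
    using fg integrable_if_square_integrable by (auto simp: ae_rel_def)
  show "spheroid_transform \<eta> a b f l = spheroid_transform \<eta> a b g l"
    unfolding spheroid_transform_def
  proof (rule integral_cong_AE)
    show "AE r in lebesgue_on {a<..<b}. spheroid_kernel \<eta> l r * f r = spheroid_kernel \<eta> l r * g r"
      using e by eventually_elim simp
  qed (intro borel_measurable_integrable integrable_spheroid_kernel_mult \<eta> f g)+
qed

subsection \<open>Classes modulo equality almost everywhere\<close>

lemma square_integrable_scale:
  "f \<in> square_integrable a b \<Longrightarrow> (\<lambda>x. t * f x) \<in> square_integrable a b"
  by (auto simp: square_integrable_def power_mult_distrib)

lemma square_integrable_add:
  assumes "f \<in> square_integrable a b" "g \<in> square_integrable a b"
  shows "(\<lambda>x. f x + g x) \<in> square_integrable a b"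
proof -
  let ?N = "lebesgue_on {a<..<b}"
  have f: "f \<in> borel_measurable ?N" "integrable ?N (\<lambda>x. (f x)\<^sup>2)"
    and g: "g \<in> borel_measurable ?N" "integrable ?N (\<lambda>x. (g x)\<^sup>2)"
    using assms by (auto simp: square_integrable_def)
  have "integrable ?N (\<lambda>x. (f x + g x)\<^sup>2)"
  proof (rule Bochner_Integration.integrable_bound)
    show "integrable ?N (\<lambda>x. 2 * (f x)\<^sup>2 + 2 * (g x)\<^sup>2)"
      using f g by auto
    show "(\<lambda>x. (f x + g x)\<^sup>2) \<in> borel_measurable ?N"
      using f g by auto
    have "(x + y)\<^sup>2 \<le> 2 * x\<^sup>2 + 2 * y\<^sup>2" for x y :: real
      using zero_le_power2[of "x - y"] by (simp add: power2_sum power2_diff)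
    then show "AE x in ?N. norm ((f x + g x)\<^sup>2) \<le> norm (2 * (f x)\<^sup>2 + 2 * (g x)\<^sup>2)"
      by auto
  qed
  with f g show ?thesis
    by (auto simp: square_integrable_def)
qed

lemma equiv_ae_rel: "equiv (square_integrable a b) (ae_rel a b)"
proof (rule equivI)
  show "ae_rel a b \<subseteq> square_integrable a b \<times> square_integrable a b"
    by (auto simp: ae_rel_def)
  show "refl_on (square_integrable a b) (ae_rel a b)"
    by (auto simp: refl_on_def ae_rel_def)
  show "sym (ae_rel a b)"
    by (auto simp: sym_def ae_rel_def)
  show "trans (ae_rel a b)"
  proof (rule transI)
    fix f g h assume "(f, g) \<in> ae_rel a b" "(g, h) \<in> ae_rel a b"
    then show "(f, h) \<in> ae_rel a b"
      unfolding ae_rel_def by auto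
  qed
qed

lemma L2_class_eqI: "(f, g) \<in> ae_rel a b \<Longrightarrow> L2_class a b f = L2_class a b g"
  unfolding L2_class_def by (rule equiv_class_eq[OF equiv_ae_rel])

lemma L2_class_eqD:
  assumes "L2_class a b f = L2_class a b g" "g \<in> square_integrable a b"
  shows "AE x in lebesgue_on {a<..<b}. f x = g x"
  using eq_equiv_class[OF assms(1)[unfolded L2_class_def] equiv_ae_rel assms(2)]
  by (simp add: ae_rel_def)

lemma L2_class_self: "f \<in> square_integrable a b \<Longrightarrow> f \<in> L2_class a b f"
  unfolding L2_class_def by (rule equiv_class_self[OF equiv_ae_rel])

lemma L2_class_in_L2: "f \<in> square_integrable a b \<Longrightarrow> L2_class a b f \<in> L2 a b"
  unfolding L2_class_def L2_def by (rule quotientI)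

lemma L2_cases:
  assumes "F \<in> L2 a b"
  obtains f where "f \<in> square_integrable a b" "F = L2_class a b f"
  using assms unfolding L2_def L2_class_def by (rule quotientE) blast

text \<open>All choices of representatives yield the same class and representatives exist, so the
  union defining the sum is a union of copies of one set.\<close>

lemma L2_add_class:
  assumes f: "f \<in> square_integrable a b" and g: "g \<in> square_integrable a b"
  shows "L2_add a b (L2_class a b f) (L2_class a b g) = L2_class a b (\<lambda>x. f x + g x)"
proof -
  have "L2_class a b (\<lambda>x. f' x + g' x) = L2_class a b (\<lambda>x. f x + g x)"
    if "f' \<in> L2_class a b f" "g' \<in> L2_class a b g" for f' g'
  proof (rule L2_class_eqI)
    show "(\<lambda>x. f' x + g' x, \<lambda>x. f x + g x) \<in> ae_rel a b"
      using that square_integrable_add by (auto simp: L2_class_def ae_rel_def)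
  qed
  then show ?thesis
    unfolding L2_add_def using L2_class_self[OF f] L2_class_self[OF g] by blast
qed

lemma L2_scale_class:
  assumes f: "f \<in> square_integrable a b"
  shows "L2_scale a b t (L2_class a b f) = L2_class a b (\<lambda>x. t * f x)"
proof -
  have "L2_class a b (\<lambda>x. t * f' x) = L2_class a b (\<lambda>x. t * f x)" if "f' \<in> L2_class a b f" for f'
  proof (rule L2_class_eqI)
    have f': "f' \<in> square_integrable a b" "AE x in lebesgue_on {a<..<b}. f x = f' x"
      using that by (auto simp: L2_class_def ae_rel_def)
    from f'(2) have "AE x in lebesgue_on {a<..<b}. t * f' x = t * f x"
      by eventually_elim simp
    then show "(\<lambda>x. t * f' x, \<lambda>x. t * f x) \<in> ae_rel a b"
      using f f'(1) square_integrable_scale by (simp add: ae_rel_def)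
  qed
  then show ?thesis
    unfolding L2_scale_def using L2_class_self[OF f] by blast
qed

text \<open>As for sums, the union collapses: all representatives have the very same transform. This
  reduces claims about classes to claims about functions.\<close>

lemma spheroid_operator_class:
  assumes \<eta>: "\<eta> > 0" and \<psi>: "\<psi> \<in> square_integrable a b"
  shows "spheroid_operator \<eta> a b L (L2_class a b \<psi>) = L2_class 0 L (spheroid_transform \<eta> a b \<psi>)"
proof -
  have "L2_class 0 L (spheroid_transform \<eta> a b \<psi>') = L2_class 0 L (spheroid_transform \<eta> a b \<psi>)"
    if "\<psi>' \<in> L2_class a b \<psi>" for \<psi>'
  proof -
    have "(\<psi>, \<psi>') \<in> ae_rel a b"
      using that by (simp add: L2_class_def)
    from spheroid_transform_cong_AE[OF \<eta> this] show ?thesis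
      by simp
  qed
  then show ?thesis
    unfolding spheroid_operator_def using L2_class_self[OF \<psi>] by blast
qed

theorem theorem3p1:
  fixes \<eta> r_min r_max l_max :: real
  assumes "\<eta> > 0" and "0 < r_min" and "r_min < r_max"
    and "l_max = 2 * r_max * max \<eta> 1"
  shows "L2_linear_operator r_min r_max 0 l_max (spheroid_operator \<eta> r_min r_max l_max) \<and>
         inj_on (spheroid_operator \<eta> r_min r_max l_max) (L2 r_min r_max)"
proof
  let ?T = "spheroid_operator \<eta> r_min r_max l_max"
  let ?t = "spheroid_transform \<eta> r_min r_max"
  note cls = spheroid_operator_class[OF assms(1)]
  note tsq = spheroid_transform_square_integrable[OF assms(1)]
  show "L2_linear_operator r_min r_max 0 l_max ?T"
    unfolding L2_linear_operator_def
  proof (intro conjI ballI allI funcsetI)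
    fix F assume "F \<in> L2 r_min r_max"
    then obtain f where f: "f \<in> square_integrable r_min r_max" "F = L2_class r_min r_max f"
      by (rule L2_cases)
    then show "?T F \<in> L2 0 l_max"
      by (simp add: cls L2_class_in_L2 tsq)
    have "?t (\<lambda>x. t * f x) = (\<lambda>l. t * ?t f l)" for t
      by (rule ext) (rule spheroid_transform_scale)
    then show "?T (L2_scale r_min r_max t F) = L2_scale 0 l_max t (?T F)" for t
      using f by (simp add: cls L2_scale_class square_integrable_scale tsq)
    fix G assume "G \<in> L2 r_min r_max"
    then obtain g where g: "g \<in> square_integrable r_min r_max" "G = L2_class r_min r_max g"
      by (rule L2_cases)
    have "?t (\<lambda>x. f x + g x) = (\<lambda>l. ?t f l + ?t g l)"
      using spheroid_transform_add[OF assms(1) f(1) g(1)] by auto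
    then show "?T (L2_add r_min r_max F G) = L2_add 0 l_max (?T F) (?T G)"
      using f g by (simp add: cls L2_add_class square_integrable_add tsq)
  qed
  show "inj_on ?T (L2 r_min r_max)"
  proof (rule inj_onI)
    fix F G assume F: "F \<in> L2 r_min r_max" and G: "G \<in> L2 r_min r_max" and eq: "?T F = ?T G"
    obtain f where f: "f \<in> square_integrable r_min r_max" "F = L2_class r_min r_max f"
      using F by (rule L2_cases)
    obtain g where g: "g \<in> square_integrable r_min r_max" "G = L2_class r_min r_max g"
      using G by (rule L2_cases)
    \<comment> \<open>The difference is spelled as a sum with a scalar multiple so that the rules
      for sums and multiples apply; by linearity, injectivity becomes triviality of the kernel of
      the operator.\<close>
    define h where "h = (\<lambda>x. f x + (- 1) * g x)"
    have h: "h \<in> square_integrable r_min r_max"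
      unfolding h_def by (rule square_integrable_add[OF f(1) square_integrable_scale[OF g(1)]])
    have th: "?t h l = ?t f l - ?t g l" for l
      unfolding h_def spheroid_transform_add[OF assms(1) f(1) square_integrable_scale[OF g(1)]]
        spheroid_transform_scale by simp
    have "L2_class 0 l_max (?t f) = L2_class 0 l_max (?t g)"
      using eq unfolding f(2) g(2) cls[OF f(1)] cls[OF g(1)] .
    then have "AE l in lebesgue_on {0<..<l_max}. ?t f l = ?t g l"
      by (rule L2_class_eqD) (rule tsq[OF g(1)])
    then have zero: "AE l in lebesgue_on {0<..<l_max}. ?t h l = 0"
      by eventually_elim (simp add: th)
    have "0 < l_max"
      using assms by (simp add: less_max_iff_disj)
    then have "AE r in lebesgue_on {r_min<..<r_max}. h r = 0"
      by (rule spheroid_transform_eq_0_imp_AE_eq_0[OF assms(1,2) _ integrable_if_square_integrable[OF h] zero])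
    then have "AE r in lebesgue_on {r_min<..<r_max}. f r = g r"
      by eventually_elim (simp add: h_def)
    then show "F = G"
      unfolding f(2) g(2) using f(1) g(1) by (intro L2_class_eqI) (simp add: ae_rel_def)
  qed
qed

end
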